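(* For all $n$, all $k\ge3$ and all $2\le s\le k$, $$|\mathcal S_n(132,\,12\cdots k)|=|\mathcal S_n(132,\,s(s+1)\cdots k\,12\cdots(s-1))|.$$
   Context: $\mathcal S_n(\tau_1,\tau_2)$ is the set of permutations $\pi=\pi_1\cdots\pi_n$ of $\{1,\dots,n\}$ avoiding both patterns $\tau_1$ and $\tau_2$, where $\pi$ avoids $\tau\in\mathcal S_k$ if there are no $i_1<\dots<i_k$ such that $\pi_{i_1}\cdots\pi_{i_k}$ is in the same relative order as $\tau_1\cdots\tau_k$. The pattern $s(s+1)\cdots k12\cdots(s-1)$ is the permutation of length $k$ given by the word $s,s+1,\dots,k,1,2,\dots,s-1$. *)

theory Defs
  imports "HOL-Combinatorics.Multiset_Permutations"
begin

text \<open>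
  A permutation of \<open>{1..n}\<close> is represented by its one-line word, that is, by an element of
  \<open>permutations_of_set {1..n}\<close>. The positions in a word are therefore counted from 0,
  while the values start at 1.
\<close>

definition order_isomorphic :: "nat list \<Rightarrow> nat list \<Rightarrow> bool" where
  "order_isomorphic xs ys \<longleftrightarrow>
     length xs = length ys \<and>
     (\<forall>a < length xs. \<forall>b < length xs. xs ! a < xs ! b \<longleftrightarrow> ys ! a < ys ! b)"

definition contains_pattern :: "nat list \<Rightarrow> nat list \<Rightarrow> bool" where
  "contains_pattern \<pi> \<tau> \<longleftrightarrow>
     (\<exists>i :: nat \<Rightarrow> nat.
        strict_mono_on {..<length \<tau>} i \<and>
        (\<forall>a < length \<tau>. i a < length \<pi>) \<and>
        order_isomorphic (map (\<lambda>a. \<pi> ! i a) [0..<length \<tau>]) \<tau>)"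

definition avoids :: "nat list \<Rightarrow> nat list \<Rightarrow> bool" where
  "avoids \<pi> \<tau> \<longleftrightarrow> \<not> contains_pattern \<pi> \<tau>"

definition avoiders2 :: "nat \<Rightarrow> nat list \<Rightarrow> nat list \<Rightarrow> nat list set" where
  "avoiders2 n \<tau>1 \<tau>2 = {\<pi> \<in> permutations_of_set {1..n}. avoids \<pi> \<tau>1 \<and> avoids \<pi> \<tau>2}"

definition increasing_pattern :: "nat \<Rightarrow> nat list" where
  "increasing_pattern k = [1..<Suc k]"

text \<open>The word \<open>s, s+1, \<dots>, k, 1, 2, \<dots>, s-1\<close>; the upper bound of \<open>[_..<_]\<close> is exclusive.\<close>

definition shifted_pattern :: "nat \<Rightarrow> nat \<Rightarrow> nat list" where
  "shifted_pattern k s = [s..<Suc k] @ [1..<s]"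

end

theory Submission
  imports Defs "HOL-Library.Sublist" "HOL-Library.Tree"
    "HOL-Computational_Algebra.Formal_Power_Series"
begin

text \<open>
  The maximum of a word avoiding 132 splits it as \<open>L m R\<close>, where every letter of \<open>L\<close> exceeds every
  letter of \<open>R\<close>, and \<open>L\<close> and \<open>R\<close> are again arbitrary words avoiding 132. Iterating this turns the
  avoiders of length \<open>n\<close> into the binary trees with \<open>n\<close> nodes (\<open>bij_betw_word\<close>), and both
  remaining patterns can be read off the tree (\<open>has_increasing_cut\<close>, \<open>has_two_runs_cut\<close>).

  An increasing subsequence cannot meet both \<open>L\<close> and \<open>R\<close>; it lies in \<open>R\<close>, or in \<open>L\<close> possibly
  followed by \<open>m\<close>. So the generating functions \<open>F\<^sub>k\<close> of the avoiders of \<open>1 2 \<dots> k\<close>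
  satisfy \<open>F\<^sub>0 = 0\<close> and \<open>F\<^sub>k\<^sub>+\<^sub>1 = 1 + x F\<^sub>k F\<^sub>k\<^sub>+\<^sub>1\<close>.
  The shifted pattern consists of two increasing runs of lengths \<open>p + 1 = k - s + 1\<close> and \<open>q = s - 1\<close>,
  the second below the first. The place between the runs is the only one where an
  occurrence can pass from \<open>L\<close> to \<open>R\<close>, so an occurrence in neither \<open>L\<close> nor \<open>R\<close> exists just when
  \<open>L\<close> contains an increasing run of length \<open>p\<close>, to be completed by \<open>m\<close>, and \<open>R\<close> one of length \<open>q\<close>.
  Inclusion-exclusion gives for the generating function \<open>G\<close> of the avoiders the linear equation
  \<open>G = 1 + x (F\<^sub>p G + G F\<^sub>q - F\<^sub>p F\<^sub>q)\<close>.

  The theorem thus becomes the addition formula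
  \<open>F\<^sub>p\<^sub>+\<^sub>q\<^sub>+\<^sub>1 (1 - x F\<^sub>p - x F\<^sub>q) = 1 - x F\<^sub>p F\<^sub>q\<close> (\<open>increasing_gf_addition\<close>),
  which expresses the addition theorem for Chebyshev polynomials of the second kind but
  follows from the recurrence of the \<open>F\<^sub>k\<close> by moving one unit at a time from \<open>q\<close> to \<open>p\<close>.
\<close>

section \<open>Patterns and subsequences\<close>

text \<open>
  The bound \<open>n\<close> makes the induction work: the last index \<open>i m\<close> bounds all earlier ones, so it takes
  over the role of \<open>n\<close> in the induction hypothesis.
\<close>

lemma subseq_of_increasing_indices:
  assumes "strict_mono_on {..<m} i" "\<forall>a<m. i a < n" "n \<le> length xs"
  shows "subseq (map (\<lambda>a. xs ! i a) [0..<m]) (take n xs)"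
  using assms
proof (induction m arbitrary: n)
  case (Suc m)
  have "i m < n" using Suc.prems(2) by blast
  have "subseq (map (\<lambda>a. xs ! i a) [0..<m]) (take (i m) xs)"
  proof (rule Suc.IH)
    show "strict_mono_on {..<m} i"
      using Suc.prems(1) by (auto simp: strict_mono_on_def)
    show "\<forall>a<m. i a < i m"
      using Suc.prems(1) by (auto simp: strict_mono_on_def)
    show "i m \<le> length xs"
      using \<open>i m < n\<close> Suc.prems(3) by linarith
  qed
  then have "subseq (map (\<lambda>a. xs ! i a) [0..<m] @ [xs ! i m]) (take (i m) xs @ [xs ! i m])"
    by (intro list_emb_append_mono) auto
  also have "take (i m) xs @ [xs ! i m] = take (Suc (i m)) xs"
    using \<open>i m < n\<close> Suc.prems(3) by (simp add: take_Suc_conv_app_nth)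
  also have "\<dots> = take (Suc (i m)) (take n xs)"
    using \<open>i m < n\<close> by (simp add: min_def Suc_le_eq)
  also have "subseq \<dots> (take n xs)"
    by (intro prefix_imp_subseq take_is_prefix)
  finally show ?case by simp
qed simp

lemma subseq_imp_increasing_indices:
  assumes "subseq ys xs"
  shows "\<exists>i. strict_mono_on {..<length ys} i \<and>
    (\<forall>a<length ys. i a < length xs \<and> ys ! a = xs ! i a)"
  using assms
proof (induction rule: list_emb.induct)
  case (list_emb_Nil xs)
  show ?case by (simp add: strict_mono_on_def)
next
  case (list_emb_Cons ys xs x)
  then obtain i where i: "strict_mono_on {..<length ys} i"
    "\<forall>a<length ys. i a < length xs \<and> ys ! a = xs ! i a" by blast
  then show ?case
    by (intro exI[of _ "\<lambda>a. Suc (i a)"]) (auto simp: strict_mono_on_def)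
next
  case (list_emb_Cons2 y x ys xs)
  then obtain i where i: "strict_mono_on {..<length ys} i"
    "\<forall>a<length ys. i a < length xs \<and> ys ! a = xs ! i a" by blast
  then show ?case using list_emb_Cons2(1)
    by (intro exI[of _ "case_nat 0 (\<lambda>a. Suc (i a))"])
      (auto simp: strict_mono_on_def nth_Cons split: nat.splits)
qed

text \<open>
  Choosing increasing positions amounts to choosing a subsequence. Subsequences split along
  concatenations of words, which is what the decomposition at the maximum requires.
\<close>

lemma contains_pattern_iff_subseq:
  "contains_pattern \<pi> \<tau> \<longleftrightarrow> (\<exists>ys. subseq ys \<pi> \<and> order_isomorphic ys \<tau>)"
proof
  assume "contains_pattern \<pi> \<tau>"
  then obtain i where "strict_mono_on {..<length \<tau>} i" "\<forall>a<length \<tau>. i a < length \<pi>"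
    and o: "order_isomorphic (map (\<lambda>a. \<pi> ! i a) [0..<length \<tau>]) \<tau>"
    unfolding contains_pattern_def by blast
  then have "subseq (map (\<lambda>a. \<pi> ! i a) [0..<length \<tau>]) \<pi>"
    using subseq_of_increasing_indices[of "length \<tau>" i "length \<pi>" \<pi>] by simp
  with o show "\<exists>ys. subseq ys \<pi> \<and> order_isomorphic ys \<tau>" by blast
next
  assume "\<exists>ys. subseq ys \<pi> \<and> order_isomorphic ys \<tau>"
  then obtain ys where ys: "subseq ys \<pi>" "order_isomorphic ys \<tau>" by blast
  obtain i where i: "strict_mono_on {..<length ys} i"
    "\<forall>a<length ys. i a < length \<pi> \<and> ys ! a = \<pi> ! i a"
    using subseq_imp_increasing_indices[OF ys(1)] by blast
  have l: "length ys = length \<tau>" using ys(2) by (simp add: order_isomorphic_def)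
  have "map (\<lambda>a. \<pi> ! i a) [0..<length \<tau>] = ys"
    using i(2) l by (intro nth_equalityI) auto
  then show "contains_pattern \<pi> \<tau>"
    unfolding contains_pattern_def using i ys(2) l by auto
qed

definition has_132 :: "nat list \<Rightarrow> bool" where
  "has_132 xs \<longleftrightarrow> (\<exists>x y z. subseq [x, y, z] xs \<and> x < z \<and> z < y)"

definition has_increasing :: "nat \<Rightarrow> nat list \<Rightarrow> bool" where
  "has_increasing k xs \<longleftrightarrow> (\<exists>u. subseq u xs \<and> length u = k \<and> sorted_wrt (<) u)"

text \<open>
  The pattern \<open>s, \<dots>, k, 1, \<dots>, s - 1\<close> for \<open>p = k - s + 1\<close> and \<open>q = s - 1\<close>, in a form that depends
  only on the lengths of its two increasing runs.
\<close>

definition has_two_runs :: "nat \<Rightarrow> nat \<Rightarrow> nat list \<Rightarrow> bool" where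
  "has_two_runs p q xs \<longleftrightarrow> (\<exists>u v. subseq (u @ v) xs \<and> length u = p \<and> length v = q \<and>
     sorted_wrt (<) u \<and> sorted_wrt (<) v \<and> (\<forall>x\<in>set u. \<forall>y\<in>set v. y < x))"

lemma order_isomorphic_132_iff:
  "order_isomorphic ys [1, 3, 2] \<longleftrightarrow> (\<exists>x y z. ys = [x, y, z] \<and> x < z \<and> z < y)"
proof
  assume o: "order_isomorphic ys [1, 3, 2]"
  then have len: "length ys = 3" by (simp add: order_isomorphic_def)
  then obtain x y z where ys: "ys = [x, y, z]"
    by (auto simp: length_Suc_conv numeral_3_eq_3)
  have "ys ! a < ys ! b \<longleftrightarrow> [1, 3, 2 :: nat] ! a < [1, 3, 2] ! b" if "a < 3" "b < 3" for a b
    using o[unfolded order_isomorphic_def len, THEN conjunct2, rule_format, OF that] .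
  from this[of 0 2] this[of 2 1] have "x < z" "z < y"
    by (simp_all add: ys)
  with ys show "\<exists>x y z. ys = [x, y, z] \<and> x < z \<and> z < y" by blast
next
  assume "\<exists>x y z. ys = [x, y, z] \<and> x < z \<and> z < y"
  then obtain x y z where xyz: "ys = [x, y, z]" "x < z" "z < y" by blast
  have "ys ! a < ys ! b \<longleftrightarrow> [1, 3, 2 :: nat] ! a < [1, 3, 2] ! b" if "a < 3" "b < 3" for a b
  proof -
    have "a = 0 \<or> a = 1 \<or> a = 2" "b = 0 \<or> b = 1 \<or> b = 2" using that by auto
    then show ?thesis using xyz by (elim disjE) simp_all
  qed
  moreover have "length ys = 3" "length [1, 3, 2 :: nat] = 3" using xyz(1) by simp_all
  ultimately show "order_isomorphic ys [1, 3, 2]"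
    unfolding order_isomorphic_def by (simp only: simp_thms) blast
qed

lemma contains_132_iff: "contains_pattern \<pi> [1, 3, 2] \<longleftrightarrow> has_132 \<pi>"
  unfolding contains_pattern_iff_subseq has_132_def order_isomorphic_132_iff by blast

lemma sorted_wrt_less_nth_iff:
  fixes xs :: "nat list"
  assumes "sorted_wrt (<) xs" "a < length xs" "b < length xs"
  shows "xs ! a < xs ! b \<longleftrightarrow> a < b"
proof -
  have "xs ! i < xs ! j" if "i < j" "j < length xs" for i j
    using assms(1) that unfolding sorted_wrt_iff_nth_less by blast
  from this[of a b] this[of b a] show ?thesis
    using assms(2,3) by (cases a b rule: linorder_cases) auto
qed

lemma contains_increasing_iff:
  "contains_pattern \<pi> (increasing_pattern k) \<longleftrightarrow> has_increasing k \<pi>"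
proof -
  have "order_isomorphic ys (increasing_pattern k) \<longleftrightarrow> length ys = k \<and> sorted_wrt (<) ys" for ys
  proof -
    have "sorted_wrt (<) ys \<longleftrightarrow> (\<forall>a<length ys. \<forall>b<length ys. ys ! a < ys ! b \<longleftrightarrow> a < b)"
      by (auto simp: sorted_wrt_less_nth_iff) (simp add: sorted_wrt_iff_nth_less)
    then show ?thesis
      by (auto simp: order_isomorphic_def increasing_pattern_def simp del: upt_Suc)
  qed
  then show ?thesis
    unfolding contains_pattern_iff_subseq has_increasing_def by auto
qed

lemma order_isomorphic_shifted_iff:
  assumes "1 \<le> s" "s \<le> k"
  shows "order_isomorphic ys (shifted_pattern k s) \<longleftrightarrow>
    (\<exists>u v. ys = u @ v \<and> length u = Suc k - s \<and> length v = s - 1 \<and>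
     sorted_wrt (<) u \<and> sorted_wrt (<) v \<and> (\<forall>x\<in>set u. \<forall>y\<in>set v. y < x))" (is "?L \<longleftrightarrow> ?R")
proof
  let ?m = "Suc k - s"
  have nth: "shifted_pattern k s ! a = (if a < ?m then s + a else Suc a - ?m)" if "a < k" for a
    using that assms by (auto simp: shifted_pattern_def nth_append simp del: upt_Suc)
  have len: "length (shifted_pattern k s) = k"
    using assms by (simp add: shifted_pattern_def del: upt_Suc)
  {
    assume ?L
    then have l: "length ys = k"
      and o: "\<And>a b. a < k \<Longrightarrow> b < k \<Longrightarrow> ys ! a < ys ! b \<longleftrightarrow>
        shifted_pattern k s ! a < shifted_pattern k s ! b"
      unfolding order_isomorphic_def len by auto
    show ?R
    proof (intro exI conjI)
      show "ys = take ?m ys @ drop ?m ys" by simp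
      show "length (take ?m ys) = ?m" "length (drop ?m ys) = s - 1" using l assms by auto
      show "sorted_wrt (<) (take ?m ys)" "sorted_wrt (<) (drop ?m ys)"
        using assms l by (auto simp: sorted_wrt_iff_nth_less o nth)
      show "\<forall>x\<in>set (take ?m ys). \<forall>y\<in>set (drop ?m ys). y < x"
      proof (intro ballI)
        fix x y
        assume "x \<in> set (take ?m ys)" and "y \<in> set (drop ?m ys)"
        then obtain a b where "a < ?m" "x = ys ! a" "b < k - ?m" "y = ys ! (?m + b)"
          using assms l by (auto simp: in_set_conv_nth)
        moreover from this have "?m + b < k" "a < k" using assms by auto
        ultimately show "y < x"
          using assms by (simp only: o nth) auto
      qed
    qed
  }
  {
    assume ?R
    then obtain u v where uv: "ys = u @ v" "length u = ?m" "length v = s - 1"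
      "sorted_wrt (<) u" "sorted_wrt (<) v" "\<forall>x\<in>set u. \<forall>y\<in>set v. y < x" by blast
    have less_u: "u ! a < u ! b \<longleftrightarrow> a < b" if "a < ?m" "b < ?m" for a b
      using uv(2,4) that by (simp add: sorted_wrt_less_nth_iff)
    have less_v: "v ! a < v ! b \<longleftrightarrow> a < b" if "a < s - 1" "b < s - 1" for a b
      using uv(3,5) that by (simp add: sorted_wrt_less_nth_iff)
    have less_vu: "v ! b < u ! a" if "a < ?m" "b < s - 1" for a b
      using uv(2,3,6) that by auto
    have "ys ! a < ys ! b \<longleftrightarrow> shifted_pattern k s ! a < shifted_pattern k s ! b"
      if "a < k" "b < k" for a b
    proof -
      consider "a < ?m" "b < ?m" | "a < ?m" "\<not> b < ?m" | "\<not> a < ?m" "b < ?m"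
        | "\<not> a < ?m" "\<not> b < ?m" by blast
      then show ?thesis
      proof cases
        case 1
        then show ?thesis using that by (simp add: nth uv(1,2) nth_append less_u)
      next
        case 2
        then have "v ! (b - ?m) < u ! a" using that assms by (intro less_vu) auto
        with 2 show ?thesis using that by (simp add: nth uv(1,2) nth_append)
      next
        case 3
        then have "v ! (a - ?m) < u ! b" using that assms by (intro less_vu) auto
        with 3 show ?thesis using that by (simp add: nth uv(1,2) nth_append)
      next
        case 4
        then have "v ! (a - ?m) < v ! (b - ?m) \<longleftrightarrow> a - ?m < b - ?m"
          using that assms by (intro less_v) auto
        with 4 show ?thesis using that by (simp add: nth uv(1,2) nth_append less_diff_iff)
      qed
    qed
    moreover have "length ys = k" using uv assms by simp
    ultimately show ?L by (simp add: order_isomorphic_def len)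
  }
qed

lemma contains_shifted_iff:
  assumes "1 \<le> s" "s \<le> k"
  shows "contains_pattern \<pi> (shifted_pattern k s) \<longleftrightarrow> has_two_runs (Suc k - s) (s - 1) \<pi>"
  unfolding contains_pattern_iff_subseq has_two_runs_def order_isomorphic_shifted_iff[OF assms]
  by blast


section \<open>Cutting a word at its maximum\<close>

text \<open>
  All cut lemmas below start from this case distinction: the chosen letters lie left and right of
  the middle letter \<open>m\<close>, which itself is either skipped or used.
\<close>

lemma subseq_around_iff:
  "subseq w (L @ m # R) \<longleftrightarrow>
    (\<exists>p r. subseq p L \<and> subseq r R \<and> (w = p @ r \<or> w = p @ m # r))"
proof
  assume "subseq w (L @ m # R)"
  then obtain p w' where w: "w = p @ w'" "subseq p L" "subseq w' (m # R)"
    by (auto simp: subseq_append_iff)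
  show "\<exists>p r. subseq p L \<and> subseq r R \<and> (w = p @ r \<or> w = p @ m # r)"
  proof (cases "\<exists>r. w' = m # r \<and> subseq r R")
    case False
    then have "subseq w' R"
      using w(3) by (cases w') (auto split: if_splits)
    with w show ?thesis by blast
  qed (use w in blast)
next
  assume "\<exists>p r. subseq p L \<and> subseq r R \<and> (w = p @ r \<or> w = p @ m # r)"
  then obtain p r where "subseq p L" "subseq r R" "w = p @ r \<or> w = p @ m # r" by blast
  then show "subseq w (L @ m # R)"
    by (auto intro!: list_emb_append_mono)
qed

lemma subseq_imp_subset: "subseq xs ys \<Longrightarrow> set xs \<subseteq> set ys"
  by (auto dest: list_emb_set)

lemma has_increasing_SucD: "has_increasing (Suc k) xs \<Longrightarrow> has_increasing k xs"
  unfolding has_increasing_def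
proof (elim exE conjE)
  fix u assume u: "subseq u xs" "length u = Suc k" "sorted_wrt (<) u"
  have "subseq (take k u) xs"
    using u(1) by (meson prefix_imp_subseq subseq_order.trans take_is_prefix)
  then show "\<exists>u. subseq u xs \<and> length u = k \<and> sorted_wrt (<) u"
    using u(2,3) by (intro exI[of _ "take k u"]) (simp add: sorted_wrt_take)
qed

lemma has_increasingI: "subseq u xs \<Longrightarrow> length u = k \<Longrightarrow> sorted_wrt (<) u \<Longrightarrow> has_increasing k xs"
  unfolding has_increasing_def by blast

lemma has_two_runsI:
  "subseq (u @ v) xs \<Longrightarrow> length u = p \<Longrightarrow> length v = q \<Longrightarrow> sorted_wrt (<) u \<Longrightarrow>
    sorted_wrt (<) v \<Longrightarrow> (\<And>x y. x \<in> set u \<Longrightarrow> y \<in> set v \<Longrightarrow> y < x) \<Longrightarrow> has_two_runs p q xs"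
  unfolding has_two_runs_def by blast

lemma pattern_subseq_mono:
  assumes "subseq xs ys"
  shows "has_132 xs \<Longrightarrow> has_132 ys"
    and "has_two_runs p q xs \<Longrightarrow> has_two_runs p q ys"
  using subseq_order.trans[OF _ assms] unfolding has_132_def has_two_runs_def by blast+

lemma subseq_parts: "subseq L (L @ m # R)" "subseq R (L @ m # R)"
  by (auto intro: list_emb_append2 prefix_imp_subseq)

context
  fixes L R :: "nat list" and m :: nat
  assumes right_below_left: "\<And>x y. x \<in> set L \<Longrightarrow> y \<in> set R \<Longrightarrow> y < x"
    and left_below_max: "\<And>x. x \<in> set L \<Longrightarrow> x < m"
    and right_below_max: "\<And>y. y \<in> set R \<Longrightarrow> y < m"
begin

text \<open>
  An occurrence of 132 lies within one side: its first letter is below its third, whereas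
  descents are forced from \<open>L\<close> to \<open>R\<close>; and \<open>m\<close> could only be the largest letter, which has one
  of the other two letters on each side.
\<close>

lemma has_132_cut: "has_132 (L @ m # R) \<longleftrightarrow> has_132 L \<or> has_132 R"
proof
  assume "has_132 (L @ m # R)"
  then obtain x y z where xyz: "subseq [x, y, z] (L @ m # R)" "x < z" "z < y"
    unfolding has_132_def by blast
  then obtain p r where pr: "subseq p L" "subseq r R"
    and eq: "[x, y, z] = p @ r \<or> [x, y, z] = p @ m # r"
    unfolding subseq_around_iff by blast
  have *: "set p \<subseteq> set L" "set r \<subseteq> set R"
    using pr subseq_imp_subset by blast+
  have "p = [] \<or> r = []"
  proof (rule ccontr)
    assume "\<not> ?thesis"
    then have "x \<in> set L" "z \<in> set R"
      using eq * by (auto simp: Cons_eq_append_conv)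
    then show False using right_below_left xyz(2) by fastforce
  qed
  moreover have "[x, y, z] \<noteq> p @ m # r"
  proof
    assume "[x, y, z] = p @ m # r"
    then consider "x = m" "r = [y, z]" | "y = m" "p = [x]" "r = [z]" | "z = m" "p = [x, y]"
      by (auto simp: Cons_eq_append_conv)
    then show False
      using * xyz(2,3) right_below_left[of x z] right_below_max[of z] left_below_max[of y]
      by cases auto
  qed
  ultimately have "[x, y, z] = p \<or> [x, y, z] = r" using eq by auto
  then show "has_132 L \<or> has_132 R"
    unfolding has_132_def using pr xyz(2,3) by blast
next
  assume "has_132 L \<or> has_132 R"
  then show "has_132 (L @ m # R)"
    using pattern_subseq_mono(1) subseq_parts by blast
qed

text \<open>
  An increasing subsequence cannot pass from \<open>L\<close> to \<open>R\<close> or from \<open>m\<close> to \<open>R\<close>, but any one in \<open>L\<close>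
  can be prolonged by \<open>m\<close>.
\<close>

lemma has_increasing_cut:
  "has_increasing (Suc k) (L @ m # R) \<longleftrightarrow> has_increasing k L \<or> has_increasing (Suc k) R"
proof
  assume "has_increasing (Suc k) (L @ m # R)"
  then obtain w where w: "subseq w (L @ m # R)" "length w = Suc k" "sorted_wrt (<) w"
    unfolding has_increasing_def by blast
  then obtain p r where pr: "subseq p L" "subseq r R" and eq: "w = p @ r \<or> w = p @ m # r"
    unfolding subseq_around_iff by blast
  have *: "set p \<subseteq> set L" "set r \<subseteq> set R"
    using pr subseq_imp_subset by blast+
  show "has_increasing k L \<or> has_increasing (Suc k) R"
    using eq
  proof
    assume wpr: "w = p @ r"
    have "p = [] \<or> r = []"
    proof (rule ccontr)
      assume "\<not> ?thesis"
      then obtain x y where "x \<in> set p" "y \<in> set r" by (meson list.set_sel(1))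
      moreover from this have "x < y" using w(3) wpr by (simp add: sorted_wrt_append)
      ultimately show False using right_below_left[of x y] * by auto
    qed
    then show ?thesis
    proof
      assume "p = []"
      then show ?thesis using has_increasingI[OF pr(2)] w wpr by simp
    next
      assume "r = []"
      then have "has_increasing (Suc k) L" using has_increasingI[OF pr(1)] w wpr by simp
      then show ?thesis by (simp add: has_increasing_SucD)
    qed
  next
    assume wpr: "w = p @ m # r"
    have "r = []"
    proof (rule ccontr)
      assume "r \<noteq> []"
      then obtain y where "y \<in> set r" by (meson list.set_sel(1))
      moreover from this have "m < y" using w(3) wpr by (simp add: sorted_wrt_append)
      ultimately show False using right_below_max[of y] * by auto
    qed
    then show ?thesis using has_increasingI[OF pr(1)] w wpr by (simp add: sorted_wrt_append)
  qed
next
  assume "has_increasing k L \<or> has_increasing (Suc k) R"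
  then show "has_increasing (Suc k) (L @ m # R)"
  proof
    assume "has_increasing k L"
    then obtain u where u: "subseq u L" "length u = k" "sorted_wrt (<) u"
      unfolding has_increasing_def by blast
    then have "sorted_wrt (<) (u @ [m])"
      using left_below_max subseq_imp_subset[OF u(1)] by (auto simp: sorted_wrt_append)
    moreover have "subseq (u @ [m]) (L @ m # R)"
      using u(1) unfolding subseq_around_iff by (intro exI[of _ u] exI[of _ "[]"]) simp
    ultimately show ?thesis using u(2) by (intro has_increasingI) auto
  next
    assume "has_increasing (Suc k) R"
    then obtain u where u: "subseq u R" "length u = Suc k" "sorted_wrt (<) u"
      unfolding has_increasing_def by blast
    then show ?thesis by (intro has_increasingI[of u]) auto
  qed
qed

text \<open>
  The pattern can descend only between its two runs. So an occurrence that lies neither in \<open>L\<close> nor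
  in \<open>R\<close> has its second run in \<open>R\<close> and its first run in \<open>L\<close> or in \<open>L\<close> followed by \<open>m\<close>. In both
  cases \<open>L\<close> contains the first \<open>p\<close> letters of the first run; conversely \<open>m\<close> can always serve as
  its last letter.
\<close>

lemma has_two_runs_cut:
  "has_two_runs (Suc p) q (L @ m # R) \<longleftrightarrow>
    has_two_runs (Suc p) q L \<or> has_two_runs (Suc p) q R \<or> has_increasing p L \<and> has_increasing q R"
proof
  assume "has_two_runs (Suc p) q (L @ m # R)"
  then obtain u v where uv: "subseq (u @ v) (L @ m # R)" "length u = Suc p" "length v = q"
    "sorted_wrt (<) u" "sorted_wrt (<) v" "\<And>x y. x \<in> set u \<Longrightarrow> y \<in> set v \<Longrightarrow> y < x"
    unfolding has_two_runs_def by blast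
  then obtain l r where lr: "subseq l L" "subseq r R" and eq: "u @ v = l @ r \<or> u @ v = l @ m # r"
    unfolding subseq_around_iff by blast
  have *: "set l \<subseteq> set L" "set r \<subseteq> set R"
    using lr subseq_imp_subset by blast+
  have no_ascent: "\<not> x < y" if "x \<in> set l" "y \<in> set r" for x y
    using right_below_left[of x y] that subsetD[OF *(1)] subsetD[OF *(2)] by auto
  obtain x0 where x0: "x0 \<in> set u" using uv(2) by (cases u) auto
  \<comment> \<open>The occurrence passes from \<open>L\<close> to \<open>R\<close> exactly between the runs, without using \<open>m\<close>.\<close>
  have split: "has_increasing p L \<and> has_increasing q R" if "u = l" "v = r"
  proof -
    have "has_increasing (Suc p) L" "has_increasing q R"
      using that lr uv by (auto intro: has_increasingI)
    then show ?thesis by (simp add: has_increasing_SucD)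
  qed
  show "has_two_runs (Suc p) q L \<or> has_two_runs (Suc p) q R \<or> has_increasing p L \<and> has_increasing q R"
    using eq
  proof
    assume "u @ v = l @ r"
    then obtain t where "u = l @ t \<and> t @ v = r \<or> u @ t = l \<and> v = t @ r"
      by (auto simp: append_eq_append_conv2)
    then show ?thesis
    proof (elim disjE conjE)
      assume t: "u = l @ t" "t @ v = r"
      have "l = [] \<or> t = []"
      proof (rule ccontr)
        assume "\<not> ?thesis"
        then obtain x y where xy: "x \<in> set l" "y \<in> set t" by (meson list.set_sel(1))
        then have "x < y" using uv(4) t by (simp add: sorted_wrt_append)
        with no_ascent[of x y] xy t(2) show False by auto
      qed
      then show ?thesis
      proof
        assume "l = []"
        then have "has_two_runs (Suc p) q R"
          using t lr(2) uv by (intro has_two_runsI[of u v]) auto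
        then show ?thesis by blast
      next
        assume "t = []"
        with t split show ?thesis by simp
      qed
    next
      assume t: "u @ t = l" "v = t @ r"
      have "t = [] \<or> r = []"
      proof (rule ccontr)
        assume "\<not> ?thesis"
        then obtain x y where xy: "x \<in> set t" "y \<in> set r" by (meson list.set_sel(1))
        then have "x < y" using uv(5) t by (simp add: sorted_wrt_append)
        with no_ascent[of x y] xy t(1) show False by auto
      qed
      then show ?thesis
      proof
        assume "r = []"
        then have "has_two_runs (Suc p) q L"
          using t lr(1) uv by (intro has_two_runsI[of u v]) auto
        then show ?thesis by blast
      next
        assume "t = []"
        with t split show ?thesis by simp
      qed
    qed
  next
    assume "u @ v = l @ m # r"
    \<comment> \<open>The first run is nonempty and lies above the second, so the maximum belongs to the first.\<close>
    moreover have "m \<notin> set v"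
    proof
      assume "m \<in> set v"
      then have "m < x0" using uv(6) x0 by blast
      moreover have "x0 \<in> set L \<union> {m} \<union> set R"
        using x0 subseq_imp_subset[OF uv(1)] by auto
      ultimately show False using left_below_max[of x0] right_below_max[of x0] by auto
    qed
    ultimately obtain t where t: "u = l @ m # t" "t @ v = r"
      by (auto simp: append_eq_append_conv2 Cons_eq_append_conv append_eq_Cons_conv)
    have "t = []"
    proof (rule ccontr)
      assume "t \<noteq> []"
      then obtain y where y: "y \<in> set t" by (meson list.set_sel(1))
      then have "m < y" using uv(4) t by (simp add: sorted_wrt_append)
      moreover have "y \<in> set R" using y t(2) *(2) by auto
      ultimately show False using right_below_max[of y] by simp
    qed
    then have "has_increasing p L" "has_increasing q R"
      using t lr uv by (auto intro!: has_increasingI simp: sorted_wrt_append)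
    then show ?thesis by blast
  qed
next
  assume "has_two_runs (Suc p) q L \<or> has_two_runs (Suc p) q R \<or> has_increasing p L \<and> has_increasing q R"
  then show "has_two_runs (Suc p) q (L @ m # R)"
  proof (elim disjE conjE)
    assume "has_two_runs (Suc p) q L"
    then show ?thesis by (rule pattern_subseq_mono(2)[OF subseq_parts(1)])
  next
    assume "has_two_runs (Suc p) q R"
    then show ?thesis by (rule pattern_subseq_mono(2)[OF subseq_parts(2)])
  next
    assume "has_increasing p L" "has_increasing q R"
    then obtain u v where u: "subseq u L" "length u = p" "sorted_wrt (<) u"
      and v: "subseq v R" "length v = q" "sorted_wrt (<) v"
      unfolding has_increasing_def by blast
    have sub: "set u \<subseteq> set L" "set v \<subseteq> set R"
      using u(1) v(1) subseq_imp_subset by blast+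
    show ?thesis
    proof (rule has_two_runsI)
      show "subseq ((u @ [m]) @ v) (L @ m # R)"
        unfolding subseq_around_iff using u(1) v(1) by (intro exI[of _ u] exI[of _ v]) simp
      show "sorted_wrt (<) (u @ [m])"
        using u(3) left_below_max sub by (auto simp: sorted_wrt_append)
      show "y < x" if "x \<in> set (u @ [m])" "y \<in> set v" for x y
        using that sub right_below_left[of x y] right_below_max[of y] by auto
    qed (use u v in auto)
  qed
qed

end


section \<open>Avoiders of 132 as binary trees\<close>

text \<open>
  The avoider encoded by a tree, read in order; the node at the root carries the maximum. The letters
  are shifted by \<open>a\<close>, so that the left subtree can be placed above the right one.
\<close>

fun word :: "nat \<Rightarrow> unit tree \<Rightarrow> nat list" where
  "word a Leaf = []"
| "word a (Node l _ r) = word (a + size r) l @ Suc (a + size l + size r) # word a r"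

lemma set_word: "set (word a t) = {a<..a + size t}"
proof (induction t arbitrary: a)
  case (Node l x r)
  show ?case unfolding word.simps set_append list.set Node.IH by auto
qed simp

lemma distinct_word: "distinct (word a t)"
  by (induction t arbitrary: a) (auto simp: set_word)

lemma length_word: "length (word a t) = size t"
  by (induction t arbitrary: a) auto

lemma word_cut:
  "has_132 (word a (Node l x r)) \<longleftrightarrow> has_132 (word (a + size r) l) \<or> has_132 (word a r)"
  "has_increasing (Suc k) (word a (Node l x r)) \<longleftrightarrow>
    has_increasing k (word (a + size r) l) \<or> has_increasing (Suc k) (word a r)"
  "has_two_runs (Suc p) q (word a (Node l x r)) \<longleftrightarrow>
    has_two_runs (Suc p) q (word (a + size r) l) \<or> has_two_runs (Suc p) q (word a r) \<or>
    has_increasing p (word (a + size r) l) \<and> has_increasing q (word a r)"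
  unfolding word.simps
  by (rule has_132_cut has_increasing_cut has_two_runs_cut; simp add: set_word)+

lemma not_has_132_word: "\<not> has_132 (word a t)"
proof (induction t arbitrary: a)
  case Leaf
  show ?case by (simp add: has_132_def)
next
  case (Node l x r)
  then show ?case by (simp add: word_cut del: word.simps)
qed

lemma word_inject: "size t = size t' \<Longrightarrow> word a t = word a t' \<Longrightarrow> t = t'"
proof (induction t arbitrary: a t')
  case (Node l x r)
  then obtain l' x' r' where t': "t' = Node l' x' r'" by (cases t') auto
  have s: "size l + size r = size l' + size r'" using Node.prems(1) t' by simp
  let ?m = "Suc (a + size l + size r)"
  have eq: "word (a + size r) l @ ?m # word a r = word (a + size r') l' @ ?m # word a r'"
    using Node.prems(2) s by (simp add: t' add.assoc)
  have "?m \<notin> set (word (a + size r) l)" "?m \<notin> set (word a r)" by (auto simp: set_word)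
  with eq have "word (a + size r) l = word (a + size r') l'" "word a r = word a r'"
    by (auto simp: append_Cons_eq_iff)
  moreover from this have "size r = size r'" "size l = size l'" by (metis length_word)+
  ultimately show ?case using Node.IH t' by auto
qed simp

text \<open>
  This recovers the letters of both sides of the maximum: since they jointly fill an interval and
  one side is below the other, each side is an interval, determined by the length of the lower one.
\<close>

lemma interval_split:
  fixes A B :: "nat set"
  assumes "A \<union> B = {a<..c}" "a \<le> c" "\<And>x y. x \<in> A \<Longrightarrow> y \<in> B \<Longrightarrow> y < x"
  shows "B = {a<..a + card B}" "A = {a + card B<..c}"
proof -
  have mem: "z \<in> A \<or> z \<in> B \<longleftrightarrow> a < z \<and> z \<le> c" for z
    using assms(1) by (simp add: set_eq_iff)
  have "\<exists>b\<ge>a. B = {a<..b}"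
  proof (cases "B = {}")
    case True
    then show ?thesis by (intro exI[of _ a]) simp
  next
    case False
    have "B \<subseteq> {a<..c}" using assms(1) by blast
    then have "finite B" by (rule finite_subset) simp
    then have max: "Max B \<in> B" "\<And>y. y \<in> B \<Longrightarrow> y \<le> Max B" using False by simp_all
    have "z \<in> B" if "a < z" "z \<le> Max B" for z
    proof -
      have "z \<notin> A" using assms(3)[OF _ max(1), of z] that(2) by linarith
      moreover have "Max B \<le> c" using mem[of "Max B"] max(1) by blast
      ultimately show ?thesis using mem[of z] that by linarith
    qed
    moreover have "a < z" if "z \<in> B" for z using mem[of z] that by blast
    ultimately have "B = {a<..Max B}"
      using max(2) by (intro equalityI subsetI) (simp_all only: greaterThanAtMost_iff)
    moreover have "a \<le> Max B" using max(1) mem[of "Max B"] by simp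
    ultimately show ?thesis by blast
  qed
  then obtain b where b: "B = {a<..b}" "a \<le> b" by blast
  then have card: "a + card B = b" by simp
  with b(1) show "B = {a<..a + card B}" by simp
  have "A \<inter> B = {}" using assms(3) by blast
  with assms(1) have "A = {a<..c} - B" by blast
  also have "\<dots> = {b<..c}" unfolding b(1) using b(2) by auto
  finally show "A = {a + card B<..c}" using card by simp
qed

lemma word_surj:
  assumes "distinct xs" "set xs = {a<..a + n}" "\<not> has_132 xs"
  shows "\<exists>t. size t = n \<and> word a t = xs"
  using assms
proof (induction n arbitrary: a xs rule: less_induct)
  case (less n)
  show ?case
  proof (cases n)
    case 0
    then show ?thesis using less.prems by (intro exI[of _ Leaf]) simp
  next
    case (Suc n')
    then have "Suc (a + n') \<in> set xs" using less.prems(2) by simp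
    then obtain L R where xs: "xs = L @ Suc (a + n') # R" by (meson split_list)
    have un: "set L \<union> set R = {a<..a + n'}"
    proof -
      have "set L \<union> set R = set xs - {Suc (a + n')}" using less.prems(1) xs by auto
      also have "\<dots> = {a<..a + n'}" unfolding less.prems(2) Suc by auto
      finally show ?thesis .
    qed
    \<comment> \<open>An ascent from \<open>L\<close> to \<open>R\<close> would form the pattern 132 with the maximum between them.\<close>
    have LR: "y < x" if "x \<in> set L" "y \<in> set R" for x y
    proof (rule ccontr)
      assume "\<not> y < x"
      moreover have "set L \<inter> set R = {}" using less.prems(1) unfolding xs by simp
      then have "x \<noteq> y" using that by blast
      moreover have "y \<in> {a<..a + n'}" using that(2) un by blast
      then have "y < Suc (a + n')" by simp
      moreover have "subseq ([x] @ Suc (a + n') # [y]) xs"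
        unfolding xs subseq_around_iff using that
        by (intro exI[of _ "[x]"] exI[of _ "[y]"]) (simp add: subseq_singleton_left)
      ultimately have "has_132 xs"
        unfolding has_132_def by (intro exI[of _ x] exI[of _ "Suc (a + n')"] exI[of _ y]) auto
      with less.prems(3) show False by blast
    qed
    have no132: "\<not> has_132 L \<and> \<not> has_132 R"
    proof -
      have "z < Suc (a + n')" if "z \<in> set L \<or> z \<in> set R" for z
      proof -
        have "z \<in> {a<..a + n'}" using that un by blast
        then show ?thesis by simp
      qed
      then show ?thesis using less.prems(3) unfolding xs by (subst (asm) has_132_cut[OF LR]) blast+
    qed
    have "distinct L" "distinct R" using less.prems(1) xs by auto
    define i j where "i = length R" and "j = length L"
    have ij: "card (set R) = i" "card (set L) = j"
      unfolding i_def j_def using \<open>distinct L\<close> \<open>distinct R\<close> by (auto simp: distinct_card)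
    note sets = interval_split[OF un _ LR, unfolded ij]
    have "j = n' - i" using sets(2) ij(2) by simp
    moreover have "i \<le> n'" using card_mono[of "{a<..a + n'}" "set R"] un ij(1) by auto
    ultimately have n': "n' = i + j" by simp
    obtain r where r: "size r = i" "word a r = R"
      using less.IH[of i R a] Suc n' \<open>distinct R\<close> sets(1) no132 by auto
    obtain l where l: "size l = j" "word (a + i) l = L"
      using less.IH[of j L "a + i"] Suc n' \<open>distinct L\<close> sets(2) no132 by (auto simp: add.assoc)
    show ?thesis
      using l r Suc n' xs by (intro exI[of _ "Node l () r"]) (simp add: add_ac)
  qed
qed

lemma bij_betw_word:
  "bij_betw (word 0) {t. size t = n} {\<pi> \<in> permutations_of_set {1..n}. avoids \<pi> [1, 3, 2]}"
proof (rule bij_betw_imageI)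
  show "inj_on (word 0) {t. size t = n}"
    by (rule inj_onI) (simp add: word_inject[of _ _ 0])
  have *: "\<pi> \<in> permutations_of_set {1..n} \<and> avoids \<pi> [1, 3, 2] \<longleftrightarrow>
      distinct \<pi> \<and> set \<pi> = {0<..0 + n} \<and> \<not> has_132 \<pi>" for \<pi>
  proof -
    have "{1..n} = {0<..0 + n}" by auto
    then show ?thesis
      unfolding avoids_def contains_132_iff permutations_of_set_def by blast
  qed
  show "word 0 ` {t. size t = n} = {\<pi> \<in> permutations_of_set {1..n}. avoids \<pi> [1, 3, 2]}"
    unfolding * using word_surj[of _ 0 n]
    by (auto simp only: image_iff mem_Collect_eq set_word distinct_word not_has_132_word)
qed

fun tree_increasing :: "nat \<Rightarrow> unit tree \<Rightarrow> bool" where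
  "tree_increasing 0 t \<longleftrightarrow> True"
| "tree_increasing (Suc k) Leaf \<longleftrightarrow> False"
| "tree_increasing (Suc k) (Node l _ r) \<longleftrightarrow> tree_increasing k l \<or> tree_increasing (Suc k) r"

text \<open>
  The first run has length \<open>p + 1\<close>: as its last letter can always be the maximum, only the remaining
  \<open>p\<close> letters enter the recursion.
\<close>

fun tree_two_runs :: "nat \<Rightarrow> nat \<Rightarrow> unit tree \<Rightarrow> bool" where
  "tree_two_runs p q Leaf \<longleftrightarrow> False"
| "tree_two_runs p q (Node l _ r) \<longleftrightarrow>
    tree_two_runs p q l \<or> tree_two_runs p q r \<or> tree_increasing p l \<and> tree_increasing q r"

lemma has_increasing_word: "has_increasing k (word a t) \<longleftrightarrow> tree_increasing k t"
proof (induction k t arbitrary: a rule: tree_increasing.induct)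
  case (1 t)
  show ?case by (auto intro: has_increasingI[of "[]"])
next
  case (2 k)
  show ?case by (simp add: has_increasing_def)
next
  case (3 k l x r)
  then show ?case by (simp add: word_cut del: word.simps)
qed

lemma has_two_runs_word: "has_two_runs (Suc p) q (word a t) \<longleftrightarrow> tree_two_runs p q t"
proof (induction t arbitrary: a)
  case Leaf
  show ?case by (simp add: has_two_runs_def)
next
  case (Node l x r)
  then show ?case by (simp add: word_cut has_increasing_word del: word.simps)
qed

lemma tree_increasing_SucD: "tree_increasing (Suc k) t \<Longrightarrow> tree_increasing k t"
  using has_increasing_SucD[of k "word 0 t"] by (simp add: has_increasing_word)

text \<open>
  This makes products simplify in the equation for the generating function: a tree without an
  increasing run of length \<open>p\<close>, or without one of length \<open>q\<close>, has no two runs either.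
\<close>

lemma tree_two_runs_imp_increasing:
  assumes "tree_two_runs p q t"
  shows "tree_increasing p t" "tree_increasing q t"
proof -
  have "tree_increasing p t \<and> tree_increasing q t" using assms
  proof (induction t)
    case (Node l x r)
    then show ?case
      by (cases p; cases q) (auto dest: tree_increasing_SucD)
  qed simp
  then show "tree_increasing p t" "tree_increasing q t" by auto
qed

section \<open>Generating functions\<close>

unbundle fps_syntax

definition tree_gf :: "(unit tree \<Rightarrow> int) \<Rightarrow> int fps" where
  "tree_gf w = Abs_fps (\<lambda>n. \<Sum>t | size t = n. w t)"

lemma trees_Suc_bij:
  "bij_betw (\<lambda>(i, l, r). Node l () r)
    (SIGMA i:{0..n}. {l. size l = i} \<times> {r. size r = n - i}) {t :: unit tree. size t = Suc n}"
proof (rule bij_betw_byWitness[where f' = "\<lambda>t. (size (left t), left t, right t)"])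
  show "\<forall>t\<in>{t. size t = Suc n}.
      (case (size (left t), left t, right t) of (i, l, r) \<Rightarrow> Node l () r) = t"
  proof
    fix t :: "unit tree" assume "t \<in> {t. size t = Suc n}"
    then show "(case (size (left t), left t, right t) of (i, l, r) \<Rightarrow> Node l () r) = t"
      by (cases t) auto
  qed
  show "(\<lambda>t. (size (left t), left t, right t)) ` {t :: unit tree. size t = Suc n}
    \<subseteq> (SIGMA i:{0..n}. {l. size l = i} \<times> {r. size r = n - i})"
  proof (rule image_subsetI)
    fix t :: "unit tree" assume "t \<in> {t. size t = Suc n}"
    then show "(size (left t), left t, right t) \<in>
        (SIGMA i:{0..n}. {l. size l = i} \<times> {r. size r = n - i})"
      by (cases t) auto
  qed
qed auto

lemma finite_trees: "finite {t :: unit tree. size t = n}"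
proof (induction n rule: less_induct)
  case (less n)
  show ?case
  proof (cases n)
    case (Suc m)
    have "finite (SIGMA i:{0..m}. {l :: unit tree. size l = i} \<times> {r :: unit tree. size r = m - i})"
      using less Suc by (intro finite_SigmaI finite_cartesian_product) auto
    then show ?thesis using bij_betw_finite[OF trees_Suc_bij] Suc by blast
  qed simp
qed

lemma tree_gf_nth_0: "tree_gf w $ 0 = w Leaf"
  by (simp add: tree_gf_def)

lemma tree_gf_nth_Suc:
  "tree_gf w $ Suc n =
    (\<Sum>i=0..n. \<Sum>l | size l = i. \<Sum>r | size r = n - i. w (Node l () r))"
proof -
  have "tree_gf w $ Suc n =
      (\<Sum>(i, l, r) \<in> (SIGMA i:{0..n}. {l. size l = i} \<times> {r. size r = n - i}). w (Node l () r))"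
    by (simp add: tree_gf_def case_prod_beta' flip: sum.reindex_bij_betw[OF trees_Suc_bij])
  also have "\<dots> = (\<Sum>i=0..n. \<Sum>l | size l = i. \<Sum>r | size r = n - i. w (Node l () r))"
    by (subst sum.Sigma[symmetric])
      (auto simp: finite_trees sum.cartesian_product case_prod_beta')
  finally show ?thesis .
qed

text \<open>
  Together with \<open>tree_gf_nth_Suc\<close> this translates a weight that is a sum of products of weights
  of the two subtrees into a polynomial expression in generating functions.
\<close>

lemma tree_gf_mult_nth:
  "(tree_gf u * tree_gf v) $ n =
    (\<Sum>i=0..n. \<Sum>l | size l = i. \<Sum>r | size r = n - i. u l * v r)"
  by (simp add: fps_mult_nth tree_gf_def sum_product)

lemma tree_gf_card: "tree_gf (\<lambda>t. of_bool (P t)) $ n = int (card {t. size t = n \<and> P t})"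
  by (simp add: tree_gf_def finite_trees Collect_conj_eq)

definition increasing_gf :: "nat \<Rightarrow> int fps" where
  "increasing_gf k = tree_gf (\<lambda>t. of_bool (\<not> tree_increasing k t))"

definition two_runs_gf :: "nat \<Rightarrow> nat \<Rightarrow> int fps" where
  "two_runs_gf p q = tree_gf (\<lambda>t. of_bool (\<not> tree_two_runs p q t))"

lemma increasing_gf_0: "increasing_gf 0 = 0"
  by (simp add: increasing_gf_def tree_gf_def fps_eq_iff)

lemma increasing_gf_Suc:
  "increasing_gf (Suc k) = 1 + fps_X * (increasing_gf k * increasing_gf (Suc k))"
proof (rule fps_ext)
  fix n
  show "increasing_gf (Suc k) $ n =
      (1 + fps_X * (increasing_gf k * increasing_gf (Suc k))) $ n"
    unfolding increasing_gf_def
    by (cases n) (simp_all add: tree_gf_nth_0 tree_gf_nth_Suc tree_gf_mult_nth of_bool_conj)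
qed

text \<open>
  A node avoids the two runs if both subtrees do and, moreover, the left one avoids a run of length
  \<open>p\<close> or the right one a run of length \<open>q\<close>. Inclusion-exclusion over this disjunction gives three
  products; the avoidance of a single run in a subtree absorbs the avoidance of two runs there.
\<close>

lemma two_runs_gf_eq:
  "two_runs_gf p q = 1 + fps_X * (increasing_gf p * two_runs_gf p q
     + two_runs_gf p q * increasing_gf q - increasing_gf p * increasing_gf q)"
proof (rule fps_ext)
  fix n
  have "of_bool (\<not> tree_two_runs p q (Node l () r)) =
      of_bool (\<not> tree_increasing p l) * of_bool (\<not> tree_two_runs p q r)
      + of_bool (\<not> tree_two_runs p q l) * of_bool (\<not> tree_increasing q r)
      - (of_bool (\<not> tree_increasing p l) * of_bool (\<not> tree_increasing q r) :: int)" for l r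
    using tree_two_runs_imp_increasing[of p q l] tree_two_runs_imp_increasing[of p q r] by auto
  then show "two_runs_gf p q $ n = (1 + fps_X * (increasing_gf p * two_runs_gf p q
     + two_runs_gf p q * increasing_gf q - increasing_gf p * increasing_gf q)) $ n"
    unfolding increasing_gf_def two_runs_gf_def
    by (cases n)
      (simp_all add: tree_gf_nth_0 tree_gf_nth_Suc tree_gf_mult_nth sum.distrib sum_subtractf
        del: tree_two_runs.simps(2))
qed

text \<open>
  Write \<open>A = F\<^sub>p\<^sub>+\<^sub>1\<close>, \<open>B = F\<^sub>q\<^sub>+\<^sub>1\<close> and \<open>H = F\<^sub>p\<^sub>+\<^sub>q\<^sub>+\<^sub>2\<close>. By the recurrence
  \<open>x F\<^sub>p A = A - 1\<close>, the formula for \<open>(p, q + 1)\<close> multiplied by \<open>A\<close> reads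
  \<open>H (1 - x A B) = A + B - A B\<close>. This is symmetric in \<open>A\<close> and \<open>B\<close>, so it is also the formula for
  \<open>(p + 1, q)\<close> multiplied by \<open>B\<close>, and \<open>B\<close> can be cancelled.
\<close>

lemma increasing_gf_addition:
  "increasing_gf (Suc (p + q)) * (1 - fps_X * increasing_gf p - fps_X * increasing_gf q) =
    1 - fps_X * increasing_gf p * increasing_gf q"
proof (induction p arbitrary: q)
  case 0
  show ?case using increasing_gf_Suc[of q] by (simp add: increasing_gf_0 algebra_simps)
next
  case (Suc p)
  let ?H = "increasing_gf (Suc (Suc p + q))"
  let ?A = "increasing_gf (Suc p)" and ?B = "increasing_gf (Suc q)"
  have A: "fps_X * increasing_gf p * ?A = ?A - 1" and B: "fps_X * increasing_gf q * ?B = ?B - 1"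
    using increasing_gf_Suc[of p] increasing_gf_Suc[of q] by (simp_all add: algebra_simps)
  have "?H * (1 - fps_X * increasing_gf p - fps_X * ?B) = 1 - fps_X * increasing_gf p * ?B"
    using Suc.IH[of "Suc q"] by simp
  then have "?H * (?A - fps_X * increasing_gf p * ?A - fps_X * ?B * ?A) =
      ?A - fps_X * increasing_gf p * ?A * ?B"
    by algebra
  then have "?H * (1 - fps_X * ?A * ?B) = ?A + ?B - ?A * ?B"
    unfolding A by algebra
  then have "?B * (?H * (1 - fps_X * ?A - fps_X * increasing_gf q)) =
      ?B * (1 - fps_X * ?A * increasing_gf q)"
    using B by algebra
  moreover have "?B \<noteq> 0"
  proof
    assume "?B = 0"
    then have "?B $ 0 = 0" by simp
    then show False by (simp add: increasing_gf_def tree_gf_nth_0)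
  qed
  ultimately show ?case by simp
qed

text \<open>
  Both series solve the same linear equation, whose coefficient has constant term 1.
\<close>

lemma two_runs_gf_eq_increasing_gf: "two_runs_gf p q = increasing_gf (Suc (p + q))"
proof -
  let ?D = "1 - fps_X * increasing_gf p - fps_X * increasing_gf q"
  have "two_runs_gf p q * ?D = 1 - fps_X * increasing_gf p * increasing_gf q"
    using two_runs_gf_eq[of p q] by algebra
  then have "two_runs_gf p q * ?D = increasing_gf (Suc (p + q)) * ?D"
    by (simp only: increasing_gf_addition)
  moreover have "?D $ 0 = 1" by simp
  then have "?D \<noteq> 0" by (metis fps_zero_nth zero_neq_one)
  ultimately show ?thesis by simp
qed

lemma card_avoiders2_132:
  assumes "\<And>t. contains_pattern (word 0 t) \<tau> \<longleftrightarrow> P t"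
  shows "int (card (avoiders2 n [1, 3, 2] \<tau>)) = tree_gf (\<lambda>t. of_bool (\<not> P t)) $ n"
proof -
  have "bij_betw (word 0) {t. size t = n \<and> \<not> P t} (avoiders2 n [1, 3, 2] \<tau>)"
  proof (rule bij_betw_subset[OF bij_betw_word[of n]])
    show "word 0 ` {t. size t = n \<and> \<not> P t} = avoiders2 n [1, 3, 2] \<tau>"
    proof -
      have "avoiders2 n [1, 3, 2] \<tau> = {\<pi> \<in> word 0 ` {t. size t = n}. \<not> contains_pattern \<pi> \<tau>}"
        unfolding bij_betw_imp_surj_on[OF bij_betw_word[of n]] avoiders2_def avoids_def by auto
      then show ?thesis using assms by auto
    qed
  qed auto
  then show ?thesis by (simp add: tree_gf_card bij_betw_same_card)
qed

theorem corollary4p11: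
  fixes n k s :: nat
  assumes "k \<ge> 3" and "2 \<le> s" and "s \<le> k"
  shows "card (avoiders2 n [1, 3, 2] (increasing_pattern k)) =
         card (avoiders2 n [1, 3, 2] (shifted_pattern k s))"
proof -
  have "int (card (avoiders2 n [1, 3, 2] (increasing_pattern k))) = increasing_gf k $ n"
    unfolding increasing_gf_def
    by (rule card_avoiders2_132) (simp add: contains_increasing_iff has_increasing_word)
  also have "increasing_gf k = two_runs_gf (k - s) (s - 1)"
    using assms by (simp add: two_runs_gf_eq_increasing_gf)
  also have "\<dots> $ n = int (card (avoiders2 n [1, 3, 2] (shifted_pattern k s)))"
    unfolding two_runs_gf_def
    by (rule card_avoiders2_132[symmetric])
      (use assms in \<open>simp add: contains_shifted_iff Suc_diff_le has_two_runs_word\<close>)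
  finally show ?thesis by simp
qed

end
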